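(* For every $n\ge1$ and every word $u\in\{0,1\}^{2n}$ that ends in $1$ and contains no factor $11$, there exists a natural number $N$ with $\beta^-(N)=u$.
   Context: Let $\varphi=(1+\sqrt5)/2$. Every integer $N\ge1$ has a unique base phi expansion $N=\sum_{i\in\mathbb Z} d_i\varphi^i$ with $d_i\in\{0,1\}$, finitely many nonzero, and $d_id_{i+1}=0$ for all $i$; with $R$ the smallest index with $d_R=1$, $\beta^-(N)=d_{-1}d_{-2}\cdots d_R$ (empty if $R\ge0$). *)

theory Defs
  imports Complex_Main "HOL-Library.Sublist"
begin

definition phi :: real where
  "phi = (1 + sqrt 5) / 2"

definition base_phi_expansion :: "nat \<Rightarrow> (int \<Rightarrow> nat) \<Rightarrow> bool" where
  "base_phi_expansion N d \<longleftrightarrow>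
     (\<forall>i. d i \<in> {0, 1}) \<and>
     finite {i. d i \<noteq> 0} \<and>
     (\<forall>i. d i * d (i + 1) = 0) \<and>
     real N = (\<Sum>i | d i \<noteq> 0. real (d i) * phi powi i)"

text \<open>Every positive integer has exactly one base phi expansion, so the description below
  denotes it.\<close>

definition base_phi_digits :: "nat \<Rightarrow> int \<Rightarrow> nat" where
  "base_phi_digits N = (THE d. base_phi_expansion N d)"

text \<open>Only meaningful for \<open>N \<ge> 1\<close>, where the set of indices with digit 1 is finite and nonempty.\<close>

definition lowest_index :: "nat \<Rightarrow> int" where
  "lowest_index N = Min {i. base_phi_digits N i = 1}"

text \<open>The word \<open>d\<^sub>-\<^sub>1 d\<^sub>-\<^sub>2 \<dots> d\<^sub>R\<close> with \<open>R\<close> the lowest index; the interval \<open>[R..-1]\<close>, and hence the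
  word, is empty if \<open>R \<ge> 0\<close>.\<close>

definition beta_minus :: "nat \<Rightarrow> nat list" where
  "beta_minus N = map (base_phi_digits N) (rev [lowest_index N..-1])"

end

theory Submission
  imports Defs "HOL-Number_Theory.Fib" "HOL-Library.Indicator_Function"
begin

text \<open>Since \<open>\<phi>\<^sup>i = F\<^sub>i \<phi> + F\<^sub>i\<^sub>-\<^sub>1\<close> for every integer \<open>i\<close>, a finite sum of powers of \<open>\<phi>\<close> is an integer iff
  the corresponding sum of the \<open>F\<^sub>i\<close> vanishes. The word \<open>u\<close> contributes \<open>-M\<close> to this sum, where
  \<open>M = (\<Sum>j. (-1)\<^sup>j u\<^sub>j F\<^sub>j)\<close>, and \<open>M \<ge> 0\<close> because the leading term \<open>F\<^sub>2\<^sub>n = F\<^sub>1 + F\<^sub>3 + \<dots> + F\<^sub>2\<^sub>n\<^sub>-\<^sub>1\<close> outweighs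
  all negative ones. The Zeckendorf representation of \<open>M\<close> supplies the digits at the indices
  \<open>\<ge> 2\<close>; the digits at 0 and 1 stay 0, so the factor 11 cannot arise at the radix point.\<close>

section \<open>Nonadjacent index sets and uniqueness of base phi expansions\<close>

text \<open>Polymorphic because it serves both integer digit positions and natural Fibonacci
  indices.\<close>

definition nonadjacent :: "'a::semiring_1 set \<Rightarrow> bool" where
  "nonadjacent A \<longleftrightarrow> (\<forall>i\<in>A. i + 1 \<notin> A)"

lemma nonadjacent_subset: "nonadjacent A \<Longrightarrow> B \<subseteq> A \<Longrightarrow> nonadjacent B"
  unfolding nonadjacent_def by blast

lemma phi_gt_1: "phi > 1"
  unfolding phi_def by (simp add: less_divide_eq)

lemma phi_square: "phi * phi = phi + 1"
  unfolding phi_def by (simp add: field_simps)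

lemma phi_powi_add_2: "phi powi (k + 2) = phi powi (k + 1) + phi powi k"
proof -
  have "phi powi (k + 2) = phi powi k * (phi * phi)"
    using phi_gt_1 by (simp add: power_int_add power2_eq_square)
  also have "\<dots> = phi powi (k + 1) + phi powi k"
    unfolding phi_square using phi_gt_1 by (simp add: power_int_add algebra_simps)
  finally show ?thesis .
qed

text \<open>Induction on the cardinality: below the maximum \<open>m\<close>, nonadjacency leaves
  only indices below \<open>m - 1\<close>, whose powers sum to less than
  \<open>phi powi (m - 1)\<close>. Together with \<open>phi powi m\<close> this stays below
  \<open>phi powi (m + 1)\<close>.\<close>

lemma sum_phi_powi_less:
  fixes A :: "int set"
  assumes "finite A" "nonadjacent A" "\<forall>i\<in>A. i < k"
  shows "(\<Sum>i\<in>A. phi powi i) < phi powi k"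
  using assms
proof (induction "card A" arbitrary: A k)
  case 0
  then show ?case using phi_gt_1 by simp
next
  case (Suc c)
  define m where "m = Max A"
  have m: "m \<in> A" using Suc m_def by (metis Max_in card.empty nat.distinct(1))
  have below: "\<forall>i\<in>A - {m}. i < m - 1"
  proof
    fix i assume i: "i \<in> A - {m}"
    then have "i \<le> m" using Suc.prems(1) m_def by simp
    moreover have "i \<noteq> m - 1" using Suc.prems(2) i m unfolding nonadjacent_def by force
    ultimately show "i < m - 1" using i by auto
  qed
  have "(\<Sum>i\<in>A. phi powi i) = phi powi m + (\<Sum>i\<in>A - {m}. phi powi i)"
    using Suc.prems(1) m by (simp add: sum.remove)
  also have "\<dots> < phi powi m + phi powi (m - 1)"
    using Suc.hyps(1)[of "A - {m}" "m - 1"] Suc.hyps(2) Suc.prems(1,2) m below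
    by (simp add: nonadjacent_subset)
  also have "\<dots> = phi powi (m + 1)"
    using phi_powi_add_2[of "m - 1"] by (simp add: algebra_simps)
  also have "\<dots> \<le> phi powi k"
    using Suc.prems(3) m phi_gt_1 by (intro power_int_increasing) auto
  finally show ?case .
qed

text \<open>At the largest index \<open>m\<close> where the sets differ, the common part above
  \<open>m\<close> cancels. What remains is at least \<open>phi powi m\<close> for the set
  containing \<open>m\<close>, but smaller for the other one by
  \<open>sum_phi_powi_less\<close>.\<close>

lemma sum_phi_powi_inj:
  fixes A B :: "int set"
  assumes "finite A" "nonadjacent A" "finite B" "nonadjacent B"
    and eq: "(\<Sum>i\<in>A. phi powi i) = (\<Sum>i\<in>B. phi powi i)"
  shows "A = B"
proof -
  \<comment> \<open>Stated for fresh sets so that it applies with the roles of the two sets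
    exchanged.\<close>
  have no_max: False
    if fin: "finite A" "finite B" and B: "nonadjacent B"
      and eq: "(\<Sum>i\<in>A. phi powi i) = (\<Sum>i\<in>B. phi powi i)"
      and m: "m \<in> A" "m \<notin> B" and above: "\<forall>i>m. i \<in> A \<longleftrightarrow> i \<in> B"
    for A B :: "int set" and m
  proof -
    have split: "(\<Sum>i\<in>C. phi powi i) = (\<Sum>i\<in>C \<inter> {..m}. phi powi i) + (\<Sum>i\<in>C \<inter> {m<..}. phi powi i)"
      if "finite C" for C
      using that by (subst sum.union_disjoint[symmetric]) (auto intro!: sum.cong)
    have "A \<inter> {m<..} = B \<inter> {m<..}" using above by auto
    then have "(\<Sum>i\<in>A \<inter> {..m}. phi powi i) = (\<Sum>i\<in>B \<inter> {..m}. phi powi i)"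
      using split[OF fin(1)] split[OF fin(2)] eq by simp
    moreover have "phi powi m \<le> (\<Sum>i\<in>A \<inter> {..m}. phi powi i)"
      using fin m phi_gt_1 by (intro member_le_sum) auto
    moreover have "(\<Sum>i\<in>B \<inter> {..m}. phi powi i) < phi powi m"
    proof (rule sum_phi_powi_less)
      show "\<forall>i\<in>B \<inter> {..m}. i < m" using m by (metis IntE atMost_iff order_le_less)
    qed (use fin B in \<open>auto intro: nonadjacent_subset\<close>)
    ultimately show False by simp
  qed
  show ?thesis
  proof (rule ccontr)
    assume "A \<noteq> B"
    define S where "S = (A - B) \<union> (B - A)"
    have S: "finite S" "S \<noteq> {}" using assms \<open>A \<noteq> B\<close> unfolding S_def by auto
    have "\<forall>i>Max S. i \<notin> S" using S by (metis Max_ge not_le)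
    then have above: "\<forall>i>Max S. i \<in> A \<longleftrightarrow> i \<in> B" unfolding S_def by blast
    have "Max S \<in> S" using S by simp
    then consider "Max S \<in> A" "Max S \<notin> B" | "Max S \<in> B" "Max S \<notin> A" unfolding S_def by blast
    then show False
      using no_max[of A B "Max S"] no_max[of B A "Max S"] assms above by cases auto
  qed
qed

text \<open>Trades digit functions for their supports, so that uniqueness becomes a question about
  index sets.\<close>

lemma base_phi_expansion_support:
  assumes "base_phi_expansion N d"
  shows "d = indicator {i. d i \<noteq> 0}" and "finite {i. d i \<noteq> 0}" and "nonadjacent {i. d i \<noteq> 0}"
    and "real N = (\<Sum>i | d i \<noteq> 0. phi powi i)"
proof -
  have 01: "d i = 0 \<or> d i = 1" for i
    using assms unfolding base_phi_expansion_def by auto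
  show "d = indicator {i. d i \<noteq> 0}"
  proof
    show "d i = indicator {i. d i \<noteq> 0} i" for i
      using 01[of i] by (auto simp: indicator_def)
  qed
  show "finite {i. d i \<noteq> 0}" using assms unfolding base_phi_expansion_def by blast
  show "nonadjacent {i. d i \<noteq> 0}"
    unfolding nonadjacent_def
  proof
    fix i assume "i \<in> {i. d i \<noteq> 0}"
    moreover have "d i * d (i + 1) = 0" using assms unfolding base_phi_expansion_def by blast
    ultimately show "i + 1 \<notin> {i. d i \<noteq> 0}" by simp
  qed
  have "(\<Sum>i | d i \<noteq> 0. real (d i) * phi powi i) = (\<Sum>i | d i \<noteq> 0. phi powi i)"
  proof (rule sum.cong[OF refl])
    show "real (d i) * phi powi i = phi powi i" if "i \<in> {i. d i \<noteq> 0}" for i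
      using that 01[of i] by auto
  qed
  then show "real N = (\<Sum>i | d i \<noteq> 0. phi powi i)"
    using assms unfolding base_phi_expansion_def by simp
qed

text \<open>Evaluates the definite description: \<open>indicator D\<close> is an expansion, and
  \<open>sum_phi_powi_inj\<close> forces every other one to have support \<open>D\<close>.\<close>

lemma base_phi_digits_eq_indicator:
  assumes "finite D" "nonadjacent D" "real N = (\<Sum>i\<in>D. phi powi i)"
  shows "base_phi_digits N = indicator D"
  unfolding base_phi_digits_def
proof (rule the_equality)
  have "{i. indicator D i \<noteq> (0::nat)} = D" by (auto simp: indicator_def)
  then show "base_phi_expansion N (indicator D)"
    using assms unfolding base_phi_expansion_def nonadjacent_def by (auto simp: indicator_def)
next
  fix d assume d: "base_phi_expansion N d"
  have "{i. d i \<noteq> 0} = D"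
    using base_phi_expansion_support(2-4)[OF d] assms by (intro sum_phi_powi_inj) auto
  then show "d = indicator D" using base_phi_expansion_support(1)[OF d] by metis
qed

section \<open>Fibonacci coefficients of powers of phi, Zeckendorf representations and
  integrality\<close>

lemma phi_power_fib: "phi ^ Suc n = real (fib (Suc n)) * phi + real (fib n)"
proof (induction n)
  case (Suc n)
  have "phi ^ Suc (Suc n) = real (fib (Suc n)) * (phi * phi) + real (fib n) * phi"
    using Suc by (simp add: algebra_simps)
  then show ?case unfolding phi_square by (simp add: algebra_simps)
qed simp

text \<open>The coefficients are the Fibonacci numbers at the negative indices \<open>- j\<close>
  and \<open>- j - 1\<close>; the induction step multiplies by 1/phi = phi - 1.\<close>

lemma phi_powi_minus_fib:
  "phi powi (- int j) = - ((-1) ^ j * real (fib j)) * phi + (-1) ^ j * real (fib (Suc j))"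
proof (induction j)
  case (Suc j)
  have inv: "phi powi - 1 = phi - 1"
    using phi_square inverse_unique[of phi "phi - 1"] by (simp add: algebra_simps power_int_minus)
  have "phi powi (- int (Suc j)) = phi powi (- int j + - 1)"
    by (simp add: algebra_simps)
  also have "\<dots> = phi powi (- int j) * (phi - 1)"
    using phi_gt_1 power_int_add[of phi "- int j" "- 1"] unfolding inv by simp
  also have "\<dots> = - ((-1) ^ j * real (fib j)) * (phi * phi - phi) + (-1) ^ j * real (fib (Suc j)) * (phi - 1)"
    unfolding Suc by (simp add: algebra_simps)
  finally show ?case unfolding phi_square by (simp add: algebra_simps)
qed simp

text \<open>Greedy choice: split off the largest Fibonacci number not exceeding \<open>M\<close> and
  represent the remainder by induction.\<close>

lemma zeckendorf_exists:
  "\<exists>Z. finite Z \<and> nonadjacent Z \<and> (\<forall>i\<in>Z. i \<ge> 2) \<and> (\<Sum>i\<in>Z. fib i) = M"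
proof (induction M rule: less_induct)
  case (less M)
  show ?case
  proof (cases "M = 0")
    case True
    then show ?thesis by (intro exI[of _ "{}"]) (simp add: nonadjacent_def)
  next
    case False
    have unbounded: "k \<le> fib (Suc (Suc k))" for k
    proof (induction k)
      case (Suc k)
      then show ?case using fib_neq_0_nat[of "Suc k"] by simp
    qed simp
    \<comment> \<open>Minimality of \<open>k\<close> gives \<open>fib k \<le> M\<close>; the values
      0 and 1 are impossible since there \<open>fib (Suc k) = 1\<close>, while \<open>M\<close> is
      positive.\<close>
    define k where "k = (LEAST k. M < fib (Suc k))"
    have "M < fib (Suc (Suc (Suc M)))" using unbounded[of "Suc M"] by simp
    then have k1: "M < fib (Suc k)" unfolding k_def by (rule LeastI)
    have "k \<noteq> 0" "k \<noteq> 1" using k1 False by (auto intro: ccontr)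
    then have k2: "k \<ge> 2" by simp
    then obtain l where l: "k = Suc l" by (cases k) auto
    then have le: "fib k \<le> M" using not_less_Least[of l "\<lambda>k. M < fib (Suc k)"] k_def by auto
    obtain Z where Z: "finite Z" "nonadjacent Z" "\<forall>i\<in>Z. i \<ge> 2" "(\<Sum>i\<in>Z. fib i) = M - fib k"
      using less.IH[of "M - fib k"] fib_neq_0_nat[of k] k2 False by auto
    \<comment> \<open>The remainder is below \<open>fib (Suc k) - fib k = fib l\<close> with
      \<open>l = k - 1\<close>, so no index adjacent to \<open>k\<close> occurs in
      \<open>Z\<close>.\<close>
    have "i < l" if "i \<in> Z" for i
    proof (rule ccontr)
      assume "\<not> i < l"
      then have "fib l \<le> fib i" by (intro fib_mono) simp
      also have "\<dots> \<le> M - fib k" using Z(1,4) that by (metis member_le_sum zero_le)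
      finally show False using k1 le unfolding l by simp
    qed
    then have "k \<notin> Z" "nonadjacent (insert k Z)"
      using Z(2) unfolding nonadjacent_def l by force+
    then show ?thesis using Z k2 le by (intro exI[of _ "insert k Z"]) auto
  qed
qed

lemma sum_fib_odd: "(\<Sum>i<n. fib (Suc (2 * i))) = fib (2 * n)"
  by (induction n) auto

lemma alternating_fib_sum_nonneg:
  assumes "finite J" "\<forall>j\<in>J. j \<le> 2 * n" "2 * n \<in> J"
  shows "(\<Sum>j\<in>J. (-1) ^ j * int (fib j)) \<ge> 0"
proof -
  let ?odd = "(\<lambda>i. 2 * i + 1) ` {..<n}"
  \<comment> \<open>As \<open>2 * n\<close> is even, the odd members of \<open>J\<close> are among
    1, 3, ..., 2n - 1. Both parity parts are written as sums over all of \<open>J\<close> so that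
    they recombine termwise at the end.\<close>
  have "(\<Sum>j\<in>J. if odd j then int (fib j) else 0) = (\<Sum>j | j \<in> J \<and> odd j. int (fib j))"
    using assms(1) by (simp add: sum.inter_filter)
  also have "\<dots> \<le> (\<Sum>j\<in>?odd. int (fib j))"
  proof (rule sum_mono2)
    show "{j \<in> J. odd j} \<subseteq> ?odd"
    proof
      fix j assume "j \<in> {j \<in> J. odd j}"
      moreover from this obtain i where "j = 2 * i + 1" by (auto elim: oddE)
      ultimately show "j \<in> ?odd" using assms(2) by force
    qed
  qed auto
  also have "\<dots> = (\<Sum>i<n. int (fib (Suc (2 * i))))"
    by (subst sum.reindex) (auto simp: inj_on_def)
  also have "\<dots> = int (fib (2 * n))"
    by (simp add: sum_fib_odd flip: of_nat_sum)
  also have "\<dots> \<le> (\<Sum>j\<in>J. if even j then int (fib j) else 0)"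
    using assms(1,3) member_le_sum[of "2 * n" J "\<lambda>j. if even j then int (fib j) else 0"] by simp
  finally have "0 \<le> (\<Sum>j\<in>J. (if even j then int (fib j) else 0) - (if odd j then int (fib j) else 0))"
    by (simp add: sum_subtractf)
  also have "\<dots> = (\<Sum>j\<in>J. (-1) ^ j * int (fib j))"
    by (intro sum.cong) auto
  finally show ?thesis .
qed

lemma integral_extension:
  assumes J: "finite J" and nonneg: "(\<Sum>j\<in>J. (-1) ^ j * int (fib j)) \<ge> 0"
  shows "\<exists>Z. finite Z \<and> nonadjacent Z \<and> (\<forall>i\<in>Z. i \<ge> 2) \<and>
    (\<Sum>i\<in>Z. phi powi int i) + (\<Sum>j\<in>J. phi powi (- int j)) \<in> \<int>"
proof -
  define M where "M = (\<Sum>j\<in>J. (-1) ^ j * int (fib j))"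
  \<comment> \<open>Nonnegativity of \<open>M\<close> makes \<open>nat M\<close> faithful, so that
    the phi-coefficient \<open>M\<close> of the sum over \<open>Z\<close> cancels the
    \<open>- M\<close> coming from \<open>J\<close>.\<close>
  obtain Z where Z: "finite Z" "nonadjacent Z" "\<forall>i\<in>Z. i \<ge> 2" "(\<Sum>i\<in>Z. fib i) = nat M"
    using zeckendorf_exists by blast
  have "(\<Sum>i\<in>Z. phi powi int i) = (\<Sum>i\<in>Z. real (fib i) * phi + real (fib (i - 1)))"
  proof (rule sum.cong)
    fix i assume "i \<in> Z"
    then have "i = Suc (i - 1)" using Z(3) by force
    then show "phi powi int i = real (fib i) * phi + real (fib (i - 1))"
      using phi_power_fib[of "i - 1"] by (simp add: power_int_def)
  qed simp
  also have "\<dots> = real (\<Sum>i\<in>Z. fib i) * phi + real (\<Sum>i\<in>Z. fib (i - 1))"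
    by (simp add: sum.distrib sum_distrib_right)
  finally have pos: "(\<Sum>i\<in>Z. phi powi int i) = of_int M * phi + real (\<Sum>i\<in>Z. fib (i - 1))"
    using nonneg Z(4) M_def by simp
  have neg: "(\<Sum>j\<in>J. phi powi (- int j)) =
      - of_int M * phi + of_int (\<Sum>j\<in>J. (-1) ^ j * int (fib (Suc j)))"
    unfolding phi_powi_minus_fib M_def
    by (simp add: sum_subtractf sum_distrib_right)
  have "(\<Sum>i\<in>Z. phi powi int i) + (\<Sum>j\<in>J. phi powi (- int j)) =
      of_int (int (\<Sum>i\<in>Z. fib (i - 1)) + (\<Sum>j\<in>J. (-1) ^ j * int (fib (Suc j))))"
    unfolding pos neg by simp
  then show ?thesis using Z by (metis Ints_of_int)
qed

section \<open>Reading the word as digits and assembling the number\<close>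

lemma not_sublist_11_nth:
  assumes "\<not> sublist [1, 1] u" "Suc i < length u"
  shows "u ! i \<noteq> 1 \<or> u ! Suc i \<noteq> 1"
proof (rule ccontr)
  assume "\<not> ?thesis"
  then have "u = take i u @ [1, 1] @ drop (Suc (Suc i)) u"
    using assms(2) by (metis Cons_nth_drop_Suc Suc_lessD append_Cons append_Nil append_take_drop_id)
  then show False using assms(1) by (metis sublist_appendI)
qed

theorem theorem7p3:
  fixes n :: nat and u :: "nat list"
  assumes "n \<ge> 1"
    and "set u \<subseteq> {0, 1}"
    and "length u = 2 * n"
    and "last u = 1"
    and "\<not> sublist [1, 1] u"
  shows "\<exists>N::nat. N \<ge> 1 \<and> beta_minus N = u"
proof -
  \<comment> \<open>The list is indexed from 0, so entry \<open>j - 1\<close> is the digit at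
    position \<open>- j\<close>.\<close>
  define J where "J = {j \<in> {1..2 * n}. u ! (j - 1) = 1}"
  have J: "finite J" "\<forall>j\<in>J. 1 \<le> j \<and> j \<le> 2 * n" unfolding J_def by auto
  have "u \<noteq> []" using assms(1,3) by auto
  then have top: "2 * n \<in> J"
    using assms(1,3,4) last_conv_nth[of u] unfolding J_def by auto
  have "nonadjacent J"
    unfolding nonadjacent_def
  proof
    fix j assume "j \<in> J"
    then show "j + 1 \<notin> J"
      using not_sublist_11_nth[OF assms(5), of "j - 1"] assms(3) unfolding J_def by auto
  qed
  obtain Z where Z: "finite Z" "nonadjacent Z" "\<forall>i\<in>Z. i \<ge> 2"
    and int: "(\<Sum>i\<in>Z. phi powi int i) + (\<Sum>j\<in>J. phi powi (- int j)) \<in> \<int>"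
    using integral_extension[OF J(1)] alternating_fib_sum_nonneg[of J n] J top by auto
  define D where "D = int ` Z \<union> (\<lambda>j. - int j) ` J"
  have finD: "finite D" using Z J unfolding D_def by simp
  have "nonadjacent D"
    unfolding nonadjacent_def
  proof (intro ballI notI)
    fix i assume i: "i \<in> D" "i + 1 \<in> D"
    show False
    proof (cases "i \<ge> 0")
      case True
      have "nat k \<in> Z" if "k \<in> D" "k \<ge> 0" for k
        using that J(2) unfolding D_def by auto
      then have "nat i \<in> Z" "nat (i + 1) \<in> Z"
        using i True by auto
      moreover have "nat (i + 1) = nat i + 1"
        using True by linarith
      ultimately show False using Z(2) unfolding nonadjacent_def by metis
    next
      case False
      \<comment> \<open>Allowing \<open>k = 0\<close> covers the pair -1, 0 across the radix point;
        elements of \<open>Z\<close> are at least 2, so a nonpositive \<open>k\<close> comes from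
        \<open>J\<close>.\<close>
      have neg: "nat (- k) \<in> J" if "k \<in> D" "k \<le> 0" for k
        using that Z(3) unfolding D_def by force
      have "nat (- i) \<in> J" "nat (- (i + 1)) \<in> J"
        using neg[of i] neg[of "i + 1"] i False by auto
      moreover have "nat (- i) = nat (- (i + 1)) + 1"
        using False by linarith
      ultimately show False using \<open>nonadjacent J\<close> unfolding nonadjacent_def by metis
    qed
  qed
  have "(\<Sum>i\<in>D. phi powi i) = (\<Sum>i\<in>int ` Z. phi powi i) + (\<Sum>i\<in>(\<lambda>j. - int j) ` J. phi powi i)"
    unfolding D_def using Z J by (intro sum.union_disjoint) force+
  then have "(\<Sum>i\<in>D. phi powi i) \<in> \<int>"
    using int by (simp add: sum.reindex inj_on_def)
  then obtain K where K: "(\<Sum>i\<in>D. phi powi i) = of_int K" by (auto elim: Ints_cases)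
  \<comment> \<open>Positivity ensures that \<open>nat K\<close> loses nothing and that
    \<open>N\<close> is at least 1.\<close>
  have "(\<Sum>i\<in>D. phi powi i) > 0"
    using finD top phi_gt_1 unfolding D_def by (intro sum_pos) auto
  then have Kpos: "K > 0" using K by simp
  define N where "N = nat K"
  have digits: "base_phi_digits N = indicator D"
    using finD \<open>nonadjacent D\<close> K Kpos N_def by (intro base_phi_digits_eq_indicator) auto
  \<comment> \<open>The final 1 of \<open>u\<close> sits at this position, so the word read off has
    exactly the length of \<open>u\<close>.\<close>
  have "Min D = - (2 * int n)"
    using finD
  proof (rule Min_eqI)
    show "- (2 * int n) \<in> D" using top unfolding D_def by force
    show "- (2 * int n) \<le> i" if "i \<in> D" for i using that J(2) unfolding D_def by force
  qed
  then have low: "lowest_index N = - (2 * int n)"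
    unfolding lowest_index_def digits by (simp add: indicator_def)
  have "beta_minus N = u"
  proof (rule nth_equalityI)
    show len: "length (beta_minus N) = length u"
      unfolding beta_minus_def low by (simp add: assms(3))
    fix i assume "i < length (beta_minus N)"
    then have i: "i < 2 * n" using len assms(3) by simp
    have "rev [- (2 * int n)..-1] ! i = - int (Suc i)"
      using i by (simp add: rev_nth)
    then have "beta_minus N ! i = indicator D (- int (Suc i))"
      using i unfolding beta_minus_def low digits by simp
    also have "\<dots> = (if u ! i = 1 then 1 else 0)"
    proof -
      \<comment> \<open>At negative positions the digit is decided by \<open>J\<close>
        alone.\<close>
      have "- int (Suc i) \<notin> int ` Z" by auto
      then have "- int (Suc i) \<in> D \<longleftrightarrow> Suc i \<in> J"
        using inj_image_mem_iff[of "\<lambda>j. - int j" "Suc i" J] unfolding D_def by (simp add: inj_def)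
      also have "\<dots> \<longleftrightarrow> u ! i = 1" using i unfolding J_def by simp
      finally show ?thesis by (simp add: indicator_def)
    qed
    also have "\<dots> = u ! i"
    proof -
      have "u ! i \<in> {0, 1}" using assms(2,3) i by (metis nth_mem subsetD)
      then show ?thesis by auto
    qed
    finally show "beta_minus N ! i = u ! i" .
  qed
  then show ?thesis using Kpos N_def by (intro exI[of _ N]) auto
qed

end
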